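(* For any positive integers $a,b,c$, $\mathrm{def}_c(S_{a,b,c})=\mathrm{def}_c(M_{a,b,c})=0$; that is, both $S_{a,b,c}$ and $M_{a,b,c}$ admit cyclic interval colorings.
   Context: All graphs are finite, simple and undirected. A proper $t$-edge coloring of $G$ is a map $\alpha:E(G)\to\{1,\dots,t\}$ giving adjacent edges distinct colors; $S(v,\alpha)$ is the set of colors on edges incident to $v$. A set $A\subseteq\{1,\dots,t\}$ is a cyclic interval modulo $t$ if $A$ or $\{1,\dots,t\}\setminus A$ is an interval of integers. A cyclic interval $t$-coloring is a proper $t$-edge coloring in which $S(v,\alpha)$ is a cyclic interval modulo $t$ for every vertex $v$. The deficiency modulo $t$ of a set $A$ of positive integers is the minimum size of a set $B$ of positive integers such that $A\cup B$ is a cyclic interval modulo $t$. For a proper $t$-edge coloring $\alpha$ of $G$, $\mathrm{def}_c(v,\alpha)$ is the deficiency modulo $t$ of $S(v,\alpha)$, $\mathrm{def}_c(G,\alpha)=\sum_{v}\mathrm{def}_c(v,\alpha)$, and the cyclic deficiency $\mathrm{def}_c(G)$ is the minimum of $\mathrm{def}_c(G,\alpha)$ over all proper edge colorings $\alpha$ of $G$ (with any number $t$ of colors); equivalently, it is the minimum number of pendant edges whose attachment to $G$ yields a graph with a cyclic interval coloring. $S_{a,b,c}$ has vertex set $\{u_0,u_1,u_2,u_3,v_1,v_2,v_3\}\cup\{x_1,\dots,x_a,y_1,\dots,y_b,z_1,\dots,z_c\}$ and edge set $\{u_1v_1,v_1u_2,u_2v_2,v_2u_3,u_3v_3,v_3u_1\}\cup\{u_0x_i,u_1x_i:1\le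 i\le a\}\cup\{u_0y_j,u_2y_j:1\le j\le b\}\cup\{u_0z_k,u_3z_k:1\le k\le c\}$. $M_{a,b,c}$ has vertex set $\{u_0,u_1,u_2,u_3\}\cup\{x_1,\dots,x_a,y_1,\dots,y_b,z_1,\dots,z_c\}$ and edge set $\{u_0x_i,u_1x_i,u_2x_i:1\le i\le a\}\cup\{u_0y_j,u_2y_j,u_3y_j:1\le j\le b\}\cup\{u_0z_k,u_3z_k,u_1z_k:1\le k\le c\}$. *)

theory Defs
  imports Main
begin

record 'v graph =
  verts :: "'v set"
  edges :: "'v set set"

definition simple_graph :: "'v graph \<Rightarrow> bool" where
  "simple_graph G \<longleftrightarrow> finite (verts G) \<and> (\<forall>e\<in>edges G. e \<subseteq> verts G \<and> card e = 2)"

definition proper_edge_coloring :: "'v graph \<Rightarrow> nat \<Rightarrow> ('v set \<Rightarrow> nat) \<Rightarrow> bool" where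
  "proper_edge_coloring G t \<alpha> \<longleftrightarrow>
     \<alpha> ` edges G \<subseteq> {1..t} \<and>
     (\<forall>e\<in>edges G. \<forall>f\<in>edges G. e \<noteq> f \<and> e \<inter> f \<noteq> {} \<longrightarrow> \<alpha> e \<noteq> \<alpha> f)"

definition colors_at :: "'v graph \<Rightarrow> ('v set \<Rightarrow> nat) \<Rightarrow> 'v \<Rightarrow> nat set" where
  "colors_at G \<alpha> v = \<alpha> ` {e \<in> edges G. v \<in> e}"

text \<open>The empty set counts as an interval (take \<open>l > u\<close>).\<close>

definition integer_interval :: "nat set \<Rightarrow> bool" where
  "integer_interval A \<longleftrightarrow> (\<exists>l u. A = {l..u})"

definition cyclic_interval :: "nat \<Rightarrow> nat set \<Rightarrow> bool" where
  "cyclic_interval t A \<longleftrightarrow>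
     A \<subseteq> {1..t} \<and> (integer_interval A \<or> integer_interval ({1..t} - A))"

definition cyclic_interval_coloring :: "'v graph \<Rightarrow> nat \<Rightarrow> ('v set \<Rightarrow> nat) \<Rightarrow> bool" where
  "cyclic_interval_coloring G t \<alpha> \<longleftrightarrow>
     proper_edge_coloring G t \<alpha> \<and> (\<forall>v\<in>verts G. cyclic_interval t (colors_at G \<alpha> v))"

text \<open>
  The minimum is over a nonempty set of naturals whenever \<open>A \<subseteq> {1..t}\<close> (take \<open>B = {1..t}\<close>);
  for other \<open>A\<close> the value is unspecified.
\<close>

definition set_deficiency :: "nat \<Rightarrow> nat set \<Rightarrow> nat" where
  "set_deficiency t A =
     (LEAST n. \<exists>B. finite B \<and> B \<subseteq> {0<..} \<and> card B = n \<and> cyclic_interval t (A \<union> B))"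

definition coloring_deficiency :: "'v graph \<Rightarrow> nat \<Rightarrow> ('v set \<Rightarrow> nat) \<Rightarrow> nat" where
  "coloring_deficiency G t \<alpha> = (\<Sum>v\<in>verts G. set_deficiency t (colors_at G \<alpha> v))"

text \<open>
  The number \<open>t\<close> of colors is part of the minimization. A finite simple graph always has a
  proper edge coloring (color all edges differently), so the minimum is attained.
\<close>

definition cyclic_deficiency :: "'v graph \<Rightarrow> nat" where
  "cyclic_deficiency G =
     (LEAST n. \<exists>t \<alpha>. proper_edge_coloring G t \<alpha> \<and> coloring_deficiency G t \<alpha> = n)"

datatype vertex = U nat | V nat | X nat | Y nat | Z nat

definition S_graph :: "nat \<Rightarrow> nat \<Rightarrow> nat \<Rightarrow> vertex graph" where
  "S_graph a b c = \<lparr>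
     verts = {U 0, U 1, U 2, U 3, V 1, V 2, V 3} \<union> X ` {1..a} \<union> Y ` {1..b} \<union> Z ` {1..c},
     edges = {{U 1, V 1}, {V 1, U 2}, {U 2, V 2}, {V 2, U 3}, {U 3, V 3}, {V 3, U 1}}
       \<union> (\<Union>i\<in>{1..a}. {{U 0, X i}, {U 1, X i}})
       \<union> (\<Union>j\<in>{1..b}. {{U 0, Y j}, {U 2, Y j}})
       \<union> (\<Union>k\<in>{1..c}. {{U 0, Z k}, {U 3, Z k}}) \<rparr>"

definition M_graph :: "nat \<Rightarrow> nat \<Rightarrow> nat \<Rightarrow> vertex graph" where
  "M_graph a b c = \<lparr>
     verts = {U 0, U 1, U 2, U 3} \<union> X ` {1..a} \<union> Y ` {1..b} \<union> Z ` {1..c},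
     edges = (\<Union>i\<in>{1..a}. {{U 0, X i}, {U 1, X i}, {U 2, X i}})
       \<union> (\<Union>j\<in>{1..b}. {{U 0, Y j}, {U 2, Y j}, {U 3, Y j}})
       \<union> (\<Union>k\<in>{1..c}. {{U 0, Z k}, {U 3, Z k}, {U 1, Z k}}) \<rparr>"

lemma simple_graph_S: "simple_graph (S_graph a b c)"
  by (auto simp: simple_graph_def S_graph_def card_2_iff)

lemma simple_graph_M: "simple_graph (M_graph a b c)"
  by (auto simp: simple_graph_def M_graph_def card_2_iff)

lemma ex_proper_edge_coloring:
  assumes "simple_graph G"
  shows "\<exists>t \<alpha>. proper_edge_coloring G t \<alpha>"
proof -
  have "edges G \<subseteq> Pow (verts G)" "finite (verts G)"
    using assms by (auto simp: simple_graph_def)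
  then have "finite (edges G)"
    by (meson finite_Pow_iff finite_subset)
  then obtain h where "bij_betw h (edges G) {1..card (edges G)}"
    using finite_same_card_bij[of "edges G" "{1..card (edges G)}"] by auto
  then have "proper_edge_coloring G (card (edges G)) h"
    by (auto simp: proper_edge_coloring_def bij_betw_def inj_on_def)
  then show ?thesis by blast
qed

end

theory Submission
  imports Defs
begin

text \<open>
  Both graphs are bipartite, with the vertices \<open>U s\<close> on one side. Number the neighbours of \<open>U 0\<close>
  consecutively by \<open>1, \<dots>, n\<close>, where \<open>n = a + b + c\<close>, and give the edge from \<open>U 0\<close> to the \<open>p\<close>-th
  neighbour the color \<open>p\<close>. The other edges at this neighbour get \<open>p + 1\<close> or \<open>p - 1\<close>, the
  same choice for all edges between a given \<open>U s\<close> and a given family. In \<open>S\<close>, the two edges from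
  \<open>U s\<close> to the \<open>V m\<close> extend the interval at \<open>U s\<close> by one on each side. With \<open>t = n + 2\<close> colors the pieces fit
  together modulo \<open>t\<close>: in \<open>S\<close> only \<open>V 3\<close> sees a set that wraps around, namely \<open>{n + 2, 1}\<close>; in \<open>M\<close> only \<open>X 1\<close> and
  \<open>U 1\<close> do.
\<close>

lemma cyclic_interval_atLeastAtMost:
  "\<lbrakk>1 \<le> l; u \<le> t\<rbrakk> \<Longrightarrow> cyclic_interval t {l..u}"
  by (auto simp: cyclic_interval_def integer_interval_def)

lemma cyclic_interval_Diff:
  assumes "1 \<le> l" "u \<le> t"
  shows "cyclic_interval t ({1..t} - {l..u})"
proof -
  have "{1..t} - ({1..t} - {l..u}) = {l..u}"
    using assms by auto
  then show ?thesis
    unfolding cyclic_interval_def integer_interval_def by blast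
qed

text \<open>The shifts \<open>j + (a + 1)\<close> and the like simplify to
  \<open>Suc (j + a)\<close>; this gives the image of an index range under such a shift.\<close>

lemma image_Suc_add_atLeastAtMost:
  "(\<lambda>i. Suc (i + k)) ` {Suc 0..m} = {Suc (Suc k)..Suc (m + k)}"
  using image_add_atLeastAtMost'[of "Suc k" "Suc 0" m] by simp

text \<open>At each vertex \<open>B = {}\<close> already works, so every summand of the deficiency
  vanishes, and 0 is the least natural number.\<close>

lemma cyclic_deficiency_eq_0:
  assumes "cyclic_interval_coloring G t \<alpha>"
  shows "cyclic_deficiency G = 0"
proof -
  have "set_deficiency t (colors_at G \<alpha> v) = 0" if "v \<in> verts G" for v
    unfolding set_deficiency_def
    by (rule Least_eq_0, rule exI[of _ "{}"])
      (use assms that in \<open>auto simp: cyclic_interval_coloring_def\<close>)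
  then have "coloring_deficiency G t \<alpha> = 0"
    by (simp add: coloring_deficiency_def)
  then show ?thesis
    unfolding cyclic_deficiency_def
    using assms by (intro Least_eq_0) (auto simp: cyclic_interval_coloring_def)
qed

text \<open>With edges oriented from \<open>P\<close> to its complement, a color may be given as a
  function of the two ends instead of an unordered pair. Properness then splits into injectivity on
  neighbourhoods, one condition for each side.\<close>

lemma bipartite_cyclic_interval_coloring:
  fixes f :: "'v \<Rightarrow> 'v \<Rightarrow> nat"
  assumes bip: "\<And>e. e \<in> edges G \<Longrightarrow> \<exists>p\<in>P. \<exists>q. q \<notin> P \<and> e = {p, q}"
    and range: "\<And>p q. \<lbrakk>p \<in> P; q \<notin> P; {p, q} \<in> edges G\<rbrakk> \<Longrightarrow> f p q \<in> {1..t}"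
    and inj1: "\<And>p. p \<in> P \<Longrightarrow> inj_on (f p) {q. {p, q} \<in> edges G}"
    and inj2: "\<And>q. q \<notin> P \<Longrightarrow> inj_on (\<lambda>p. f p q) {p. {p, q} \<in> edges G}"
    and int1: "\<And>p. \<lbrakk>p \<in> verts G; p \<in> P\<rbrakk> \<Longrightarrow> cyclic_interval t (f p ` {q. {p, q} \<in> edges G})"
    and int2: "\<And>q. \<lbrakk>q \<in> verts G; q \<notin> P\<rbrakk> \<Longrightarrow> cyclic_interval t ((\<lambda>p. f p q) ` {p. {p, q} \<in> edges G})"
  shows "\<exists>\<alpha>. cyclic_interval_coloring G t \<alpha>"
proof -
  \<comment> \<open>Every edge has exactly one end in \<open>P\<close> and one outside, so both
    descriptions are unique on edges.\<close>
  define \<alpha> where "\<alpha> e = f (THE p. p \<in> e \<and> p \<in> P) (THE q. q \<in> e \<and> q \<notin> P)" for e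
  have \<alpha>: "\<alpha> {p, q} = f p q" if "p \<in> P" "q \<notin> P" for p q
  proof -
    have "(THE r. r \<in> {p, q} \<and> r \<in> P) = p" "(THE r. r \<in> {p, q} \<and> r \<notin> P) = q"
      using that by (auto intro!: the_equality)
    then show ?thesis by (simp add: \<alpha>_def)
  qed
  have sides: "p \<in> P \<longleftrightarrow> q \<notin> P" if "{p, q} \<in> edges G" for p q
    using bip[OF that] by (auto simp: doubleton_eq_iff)
  have col1: "colors_at G \<alpha> p = f p ` {q. {p, q} \<in> edges G}" if "p \<in> P" for p
  proof -
    have "{e \<in> edges G. p \<in> e} = (\<lambda>q. {p, q}) ` {q. {p, q} \<in> edges G}"
      using bip by (fastforce simp: insert_commute)
    then show ?thesis
      using sides that by (auto simp: colors_at_def image_image \<alpha> intro!: image_cong)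
  qed
  have col2: "colors_at G \<alpha> q = (\<lambda>p. f p q) ` {p. {p, q} \<in> edges G}" if "q \<notin> P" for q
  proof -
    have "{e \<in> edges G. q \<in> e} = (\<lambda>p. {p, q}) ` {p. {p, q} \<in> edges G}"
      using bip by (fastforce simp: insert_commute)
    then show ?thesis
      using sides that by (auto simp: colors_at_def image_image \<alpha> intro!: image_cong)
  qed
  have "\<alpha> e \<in> {1..t}" if "e \<in> edges G" for e
    using bip[OF that] range that \<alpha> by metis
  moreover have "\<alpha> e \<noteq> \<alpha> e'"
    if e: "e \<in> edges G" and e': "e' \<in> edges G" and "e \<noteq> e'" "e \<inter> e' \<noteq> {}" for e e'
  proof -
    obtain p q where pq: "p \<in> P" "q \<notin> P" "e = {p, q}" using bip[OF e] by blast
    obtain p' q' where pq': "p' \<in> P" "q' \<notin> P" "e' = {p', q'}" using bip[OF e'] by blast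
    \<comment> \<open>A common end of two edges lies on the same side in both; were both ends
      common, the edges would be equal.\<close>
    consider "p = p'" "q \<noteq> q'" | "q = q'" "p \<noteq> p'"
      using \<open>e \<noteq> e'\<close> \<open>e \<inter> e' \<noteq> {}\<close> pq pq' by auto
    then show ?thesis
    proof cases
      case 1
      then show ?thesis
        using inj_onD[OF inj1[OF pq(1)], of q q'] e e' pq pq' \<alpha> by auto
    next
      case 2
      then show ?thesis
        using inj_onD[OF inj2[OF pq(2)], of p p'] e e' pq pq' \<alpha> by auto
    qed
  qed
  ultimately have "proper_edge_coloring G t \<alpha>"
    by (auto simp: proper_edge_coloring_def)
  moreover have "cyclic_interval t (colors_at G \<alpha> v)" if "v \<in> verts G" for v
    using that int1 int2 col1 col2 by (cases "v \<in> P") auto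
  ultimately show ?thesis
    unfolding cyclic_interval_coloring_def by blast
qed

text \<open>The families at \<open>U 1\<close>, \<open>U 2\<close>, \<open>U 3\<close> occupy the
  consecutive blocks from 2 to n + 1, where n = a + b + c. The intervals of \<open>U 1\<close> and
  \<open>U 2\<close> overlap in \<open>{a + 1, a + 2}\<close>, used at \<open>V 1\<close>; those of
  \<open>U 2\<close> and \<open>U 3\<close> in \<open>{a + b + 1, a + b + 2}\<close>, used at
  \<open>V 2\<close>. The last case is \<open>V 3\<close>, with the extreme colors n + 2 and
  1.\<close>

fun S_color :: "nat \<Rightarrow> nat \<Rightarrow> nat \<Rightarrow> vertex \<Rightarrow> vertex \<Rightarrow> nat" where
  "S_color a b c (U s) (X i) = (if s = 0 then i else i + 1)"
| "S_color a b c (U s) (Y j) = (if s = 0 then j + a else j + (a + 1))"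
| "S_color a b c (U s) (Z k) = (if s = 0 then k + (a + b) else k + (a + b + 1))"
| "S_color a b c (U s) (V m) =
     (if m = 1 then if s = 1 then a + 2 else a + 1
      else if m = 2 then if s = 2 then a + b + 2 else a + b + 1
      else if s = 3 then a + b + c + 2 else 1)"
| "S_color a b c _ _ = 0"

text \<open>Relative to the color from \<open>U 0\<close>, \<open>U 2\<close> always shifts by +1
  and \<open>U 3\<close> by -1, while \<open>U 1\<close> shifts by -1 on the \<open>X i\<close> and
  +1 on the \<open>Z k\<close>; so each family meets all of 0, +1, -1. For \<open>X 1\<close> the
  shift by -1 would give 0, which is replaced by the congruent color n + 2.\<close>

fun M_color :: "nat \<Rightarrow> nat \<Rightarrow> nat \<Rightarrow> vertex \<Rightarrow> vertex \<Rightarrow> nat" where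
  "M_color a b c (U s) (X i) =
     (if s = 0 then i else if s = 2 then i + 1 else if i = 1 then a + b + c + 2 else i - 1)"
| "M_color a b c (U s) (Y j) =
     (if s = 0 then j + a else if s = 2 then j + (a + 1) else j + (a - 1))"
| "M_color a b c (U s) (Z k) =
     (if s = 0 then k + (a + b) else if s = 1 then k + (a + b + 1) else k + (a + b - 1))"
| "M_color a b c _ _ = 0"

lemma S_graph_coloring: "\<exists>\<alpha>. cyclic_interval_coloring (S_graph a b c) (a + b + c + 2) \<alpha>"
proof (rule bipartite_cyclic_interval_coloring[where P = "range U" and f = "S_color a b c"])
  let ?G = "S_graph a b c" and ?t = "a + b + c + 2"
  \<comment> \<open>Neighbourhoods become images of index ranges, so the color sets are unions of
    translated intervals.\<close>
  have N0: "{q. {U 0, q} \<in> edges ?G} = X ` {1..a} \<union> Y ` {1..b} \<union> Z ` {1..c}"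
    and N1: "{q. {U 1, q} \<in> edges ?G} = {V 1, V 3} \<union> X ` {1..a}"
    and N2: "{q. {U 2, q} \<in> edges ?G} = {V 1, V 2} \<union> Y ` {1..b}"
    and N3: "{q. {U 3, q} \<in> edges ?G} = {V 2, V 3} \<union> Z ` {1..c}"
    and NV: "{p. {p, V 1} \<in> edges ?G} = {U 1, U 2}" "{p. {p, V 2} \<in> edges ?G} = {U 2, U 3}"
      "{p. {p, V 3} \<in> edges ?G} = {U 3, U 1}"
    by (auto simp: S_graph_def doubleton_eq_iff)
  have NX: "{p. {p, X i} \<in> edges ?G} = (if i \<in> {1..a} then {U 0, U 1} else {})"
    and NY: "{p. {p, Y i} \<in> edges ?G} = (if i \<in> {1..b} then {U 0, U 2} else {})"
    and NZ: "{p. {p, Z i} \<in> edges ?G} = (if i \<in> {1..c} then {U 0, U 3} else {})" for i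
    by (auto simp: S_graph_def doubleton_eq_iff)
  show "\<exists>p\<in>range U. \<exists>q. q \<notin> range U \<and> e = {p, q}" if "e \<in> edges ?G" for e
    using that by (auto simp: S_graph_def doubleton_eq_iff)
  show "S_color a b c p q \<in> {1..?t}" if "p \<in> range U" "q \<notin> range U" "{p, q} \<in> edges ?G" for p q
    using that by (auto simp: S_graph_def doubleton_eq_iff)
  show "inj_on (S_color a b c p) {q. {p, q} \<in> edges ?G}" if "p \<in> range U" for p
    using that by (auto simp: inj_on_def S_graph_def doubleton_eq_iff)
  show "inj_on (\<lambda>p. S_color a b c p q) {p. {p, q} \<in> edges ?G}" if "q \<notin> range U" for q
    using that by (auto simp: inj_on_def S_graph_def doubleton_eq_iff)
  show "cyclic_interval ?t (S_color a b c p ` {q. {p, q} \<in> edges ?G})"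
    if "p \<in> verts ?G" "p \<in> range U" for p
  proof -
    have "S_color a b c (U 0) ` {q. {U 0, q} \<in> edges ?G} = {1..a + b + c}"
      unfolding N0 by (simp add: image_Un image_image) auto
    moreover have "S_color a b c (U 1) ` {q. {U 1, q} \<in> edges ?G} = {1..a + 2}"
      unfolding N1 by (simp add: image_Un image_image del: One_nat_def) auto
    moreover have "S_color a b c (U 2) ` {q. {U 2, q} \<in> edges ?G} = {a + 1..a + b + 2}"
      unfolding N2 by (simp add: image_Un image_image image_Suc_add_atLeastAtMost) auto
    moreover have "S_color a b c (U 3) ` {q. {U 3, q} \<in> edges ?G} = {a + b + 1..a + b + c + 2}"
      unfolding N3 by (simp add: image_Un image_image image_Suc_add_atLeastAtMost) auto
    moreover have "p \<in> {U 0, U 1, U 2, U 3}"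
      using that by (auto simp: S_graph_def)
    ultimately show ?thesis
      by (auto simp del: One_nat_def intro!: cyclic_interval_atLeastAtMost)
  qed
  show "cyclic_interval ?t ((\<lambda>p. S_color a b c p q) ` {p. {p, q} \<in> edges ?G})"
    if q: "q \<in> verts ?G" "q \<notin> range U" for q
  proof -
    have pair: "cyclic_interval ?t {m, m + 1}" if "1 \<le> m" "m + 1 \<le> ?t" for m
    proof -
      have "{m, m + 1} = {m..m + 1}" by auto
      with that show ?thesis using cyclic_interval_atLeastAtMost by metis
    qed
    consider "q = V 1" | "q = V 2" | "q = V 3" | i where "q = X i" "i \<in> {1..a}"
      | i where "q = Y i" "i \<in> {1..b}" | i where "q = Z i" "i \<in> {1..c}"
      using q by (auto simp: S_graph_def)
    then show ?thesis
    proof cases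
      case 1
      then show ?thesis using pair[of "a + 1"] by (simp add: NV[simplified] insert_commute)
    next
      case 2
      then show ?thesis using pair[of "a + b + 1"] by (simp add: NV insert_commute)
    next
      case 3
      \<comment> \<open>The colors \<open>?t\<close> and 1 are adjacent modulo \<open>?t\<close>:
        what they leave out is an interval.\<close>
      have "{?t, 1} = {1..?t} - {2..a + b + c + 1}" by auto
      with 3 show ?thesis using cyclic_interval_Diff[of 2 "a + b + c + 1" ?t] by (simp add: NV)
    next
      case (4 i)
      then show ?thesis using pair[of i] by (simp add: NX)
    next
      case (5 i)
      then show ?thesis using pair[of "i + a"] by (simp add: NY)
    next
      case (6 i)
      then show ?thesis using pair[of "i + (a + b)"] by (simp add: NZ)
    qed
  qed
qed

lemma M_graph_coloring:
  assumes "a > 0" "b > 0" "c > 0"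
  shows "\<exists>\<alpha>. cyclic_interval_coloring (M_graph a b c) (a + b + c + 2) \<alpha>"
proof (rule bipartite_cyclic_interval_coloring[where P = "range U" and f = "M_color a b c"])
  let ?G = "M_graph a b c" and ?t = "a + b + c + 2"
  have N0: "{q. {U 0, q} \<in> edges ?G} = X ` {1..a} \<union> Y ` {1..b} \<union> Z ` {1..c}"
    and N1: "{q. {U 1, q} \<in> edges ?G} = X ` {1..a} \<union> Z ` {1..c}"
    and N2: "{q. {U 2, q} \<in> edges ?G} = X ` {1..a} \<union> Y ` {1..b}"
    and N3: "{q. {U 3, q} \<in> edges ?G} = Y ` {1..b} \<union> Z ` {1..c}"
    by (auto simp: M_graph_def doubleton_eq_iff)
  have NX: "{p. {p, X i} \<in> edges ?G} = (if i \<in> {1..a} then {U 0, U 1, U 2} else {})"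
    and NY: "{p. {p, Y i} \<in> edges ?G} = (if i \<in> {1..b} then {U 0, U 2, U 3} else {})"
    and NZ: "{p. {p, Z i} \<in> edges ?G} = (if i \<in> {1..c} then {U 0, U 3, U 1} else {})" for i
    by (auto simp: M_graph_def doubleton_eq_iff)
  show "\<exists>p\<in>range U. \<exists>q. q \<notin> range U \<and> e = {p, q}" if "e \<in> edges ?G" for e
    using that by (auto simp: M_graph_def doubleton_eq_iff)
  show "M_color a b c p q \<in> {1..?t}" if "p \<in> range U" "q \<notin> range U" "{p, q} \<in> edges ?G" for p q
    using that assms by (auto simp: M_graph_def doubleton_eq_iff)
  show "inj_on (M_color a b c p) {q. {p, q} \<in> edges ?G}" if "p \<in> range U" for p
    using that assms by (auto simp: inj_on_def M_graph_def doubleton_eq_iff split: if_splits)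
  show "inj_on (\<lambda>p. M_color a b c p q) {p. {p, q} \<in> edges ?G}" if "q \<notin> range U" for q
    using that assms by (auto simp: inj_on_def M_graph_def doubleton_eq_iff split: if_splits)
  show "cyclic_interval ?t (M_color a b c p ` {q. {p, q} \<in> edges ?G})"
    if "p \<in> verts ?G" "p \<in> range U" for p
  proof -
    have "M_color a b c (U 0) ` {q. {U 0, q} \<in> edges ?G} = {1..a + b + c}"
      unfolding N0 by (simp add: image_Un image_image) auto
    then have "cyclic_interval ?t (M_color a b c (U 0) ` {q. {U 0, q} \<in> edges ?G})"
      by (simp add: cyclic_interval_atLeastAtMost)
    moreover have "M_color a b c (U 2) ` {q. {U 2, q} \<in> edges ?G} = {2..a + b + 1}"
      unfolding N2 by (simp add: image_Un image_image image_Suc_add_atLeastAtMost) auto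
    then have "cyclic_interval ?t (M_color a b c (U 2) ` {q. {U 2, q} \<in> edges ?G})"
      by (simp add: cyclic_interval_atLeastAtMost)
    moreover have "M_color a b c (U 3) ` {q. {U 3, q} \<in> edges ?G} = {a..a + b + c - 1}"
    proof -
      \<comment> \<open>Writing \<open>a\<close> as a successor removes the truncated subtractions
        in \<open>a - 1\<close> and \<open>a + b - 1\<close>.\<close>
      obtain a' where "a = Suc a'" using assms gr0_conv_Suc by blast
      then show ?thesis
        unfolding N3 using assms by (simp add: image_Un image_image) auto
    qed
    then have "cyclic_interval ?t (M_color a b c (U 3) ` {q. {U 3, q} \<in> edges ?G})"
      using assms by (simp add: cyclic_interval_atLeastAtMost)
    moreover have "(\<lambda>i. M_color a b c (U 1) (X i)) ` {1..a} = insert ?t {1..a - 1}"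
    proof -
      \<comment> \<open>The exceptional index 1 is split off; the shift by -1 then undoes
        \<open>Suc\<close> on the rest.\<close>
      have "{1..a} = insert 1 (Suc ` {1..a - 1})"
        using assms by (auto simp: image_Suc_atLeastAtMost)
      moreover have "(\<lambda>i. M_color a b c (U 1) (X i)) ` Suc ` {1..a - 1} = {1..a - 1}"
        by (force simp: image_image)
      ultimately show ?thesis by (simp only: image_insert) simp
    qed
    \<comment> \<open>The \<open>Z k\<close> contribute \<open>{a + b + 2..a + b + c + 1}\<close>,
      which joins \<open>{1..a - 1}\<close> through the color \<open>?t\<close>; only the middle
      block is missing.\<close>
    then have "M_color a b c (U 1) ` {q. {U 1, q} \<in> edges ?G} = {1..?t} - {a..a + b + 1}"
      unfolding N1 using assms by (simp add: image_Un image_image del: One_nat_def) auto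
    then have "cyclic_interval ?t (M_color a b c (U 1) ` {q. {U 1, q} \<in> edges ?G})"
      using cyclic_interval_Diff[of a "a + b + 1" ?t] assms by simp
    moreover have "p \<in> {U 0, U 1, U 2, U 3}"
      using that by (auto simp: M_graph_def)
    ultimately show ?thesis by blast
  qed
  show "cyclic_interval ?t ((\<lambda>p. M_color a b c p q) ` {p. {p, q} \<in> edges ?G})"
    if q: "q \<in> verts ?G" "q \<notin> range U" for q
  proof -
    \<comment> \<open>Here \<open>m\<close> is the color from \<open>U 0\<close>. The bound
      \<open>2 \<le> m\<close> keeps \<open>m - 1\<close> a color; it holds for the \<open>Y\<close>
      and \<open>Z\<close> families since \<open>a > 0\<close>, and fails only at
      \<open>X 1\<close>.\<close>
    have triple: "cyclic_interval ?t {m, m + 1, m - 1}" if "2 \<le> m" "m + 1 \<le> ?t" for m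
    proof -
      have "{m, m + 1, m - 1} = {m - 1..m + 1}" using that by auto
      with that show ?thesis by (simp add: cyclic_interval_atLeastAtMost)
    qed
    consider "q = X 1" | i where "q = X i" "i \<in> {2..a}"
      | i where "q = Y i" "i \<in> {1..b}" | i where "q = Z i" "i \<in> {1..c}"
      using q by (fastforce simp: M_graph_def)
    then show ?thesis
    proof cases
      case 1
      \<comment> \<open>At \<open>X 1\<close> the colors come from \<open>U 0\<close>,
        \<open>U 1\<close>, \<open>U 2\<close> in this order and are consecutive across the
        wrap.\<close>
      have "{1, ?t, 2} = {1..?t} - {3..a + b + c + 1}" by auto
      with 1 show ?thesis
        using cyclic_interval_Diff[of 3 "a + b + c + 1" ?t] assms NX[of 1] by (simp add: numeral_2_eq_2)
    next
      case (2 i)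
      then show ?thesis using triple[of i] by (simp add: NX insert_commute)
    next
      case (3 i)
      then show ?thesis using triple[of "i + a"] assms by (simp add: NY)
    next
      case (4 i)
      then show ?thesis using triple[of "i + (a + b)"] assms by (simp add: NZ insert_commute)
    qed
  qed
qed

theorem theorem4:
  fixes a b c :: nat
  assumes "a > 0" and "b > 0" and "c > 0"
  shows "cyclic_deficiency (S_graph a b c) = 0 \<and> cyclic_deficiency (M_graph a b c) = 0 \<and>
    (\<exists>t \<alpha>. cyclic_interval_coloring (S_graph a b c) t \<alpha>) \<and>
    (\<exists>t \<alpha>. cyclic_interval_coloring (M_graph a b c) t \<alpha>)"
  using S_graph_coloring[of a b c] M_graph_coloring[OF assms] cyclic_deficiency_eq_0 by blast

end
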